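(* For a bounded one-parameter family $F_t$ on $\mathbb{R}^d$, there is a ball $B$ such that the attractor $A_t$ of $F_t$ is contained in $B$ for all $t\in[0,t_0)$.
   Context: A function $f:\mathbb{R}^d\to\mathbb{R}^d$ is affine if $f(x)=Lx+a$, where $L$ is a non-singular $d\times d$ real matrix (the linear part of $f$) and $a\in\mathbb{R}^d$. A one-parameter affine family is given by $N\ge 2$ affine functions $F=\{f_1,\dots,f_N\}$ on $\mathbb{R}^d$ and vectors $q_1,\dots,q_N\in\mathbb{R}^d$; for each real $t\ge 0$ it is $F_t=\{f_{(i,t)} : 1\le i\le N\}$ with $f_{(i,t)}(x)=t f_i(x)+q_i$. It is a similarity family if each function is a similarity transformation. The Hutchinson operator of $F_t$ on non-empty compact sets is $F_t(K)=\bigcup_{f\in F_t} f(K)$. A non-empty compact set $A_t$ is the attractor of $F_t$ if $A_t=\lim_{k\to\infty}F_t^k(K)$ in the Hausdorff metric for every non-empty compact $K$. If $L_1,\dots,L_N$ are the linear parts of $f_1,\dots,f_N$, the joint spectral radius of $F$ is $\rho(F)=\limsup_{k\to\infty}\big(\max\|L_{i_1}\cdots L_{i_k}\|\big)^{1/k}$, the maximum being over all words of length $k$ in $\{1,\dots,N\}$. Set $t_0=1/\rho(F)$; the attractor $A_t$ exists exactly for $t\in[0,t_0)$. Functions $f,g$ on $\mathbb{R}^d$ are conjugate by a function $h$ if $g=h^{-1}fh$. The family $F_t$ is semi-linear if, for all $i$ and all $t\in[0,t_0)$, $f_{(i,t)}$ is conjugate to a linear function by a function $h_i$ independent of $t$.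 A one-parameter similarity family $F_t$ is bounded if it is semi-linear and there is a unique function $\widehat f_t(x)=t\widehat f(x)+q_*\in F_t$ such that $\widehat f$ has maximum scaling ratio (among $f_1,\dots,f_N$). *)

theory Defs
  imports "HOL-Analysis.Analysis"
begin

definition nonsingular_affine :: "(real^'d \<Rightarrow> real^'d) \<Rightarrow> bool" where
  "nonsingular_affine f \<longleftrightarrow> (\<exists>L a. invertible L \<and> f = (\<lambda>x. L *v x + a))"

definition linear_part :: "(real^'d \<Rightarrow> real^'d) \<Rightarrow> real^'d^'d" where
  "linear_part f = (THE L. \<exists>a. f = (\<lambda>x. L *v x + a))"

definition similarity :: "(real^'d \<Rightarrow> real^'d) \<Rightarrow> bool" where
  "similarity f \<longleftrightarrow> (\<exists>r>0. \<forall>x y. dist (f x) (f y) = r * dist x y)"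

definition scaling_ratio :: "(real^'d \<Rightarrow> real^'d) \<Rightarrow> real" where
  "scaling_ratio f = (THE r. \<forall>x y. dist (f x) (f y) = r * dist x y)"

(* A one-parameter family is given by N, the functions f 1, ..., f N and the vectors
   q 1, ..., q N; the values of f and q outside {1..N} are irrelevant. *)

definition affine_family ::
    "nat \<Rightarrow> (nat \<Rightarrow> real^'d \<Rightarrow> real^'d) \<Rightarrow> (nat \<Rightarrow> real^'d) \<Rightarrow> bool" where
  "affine_family N f q \<longleftrightarrow> N \<ge> 2 \<and> (\<forall>i\<in>{1..N}. nonsingular_affine (f i))"

definition similarity_family ::
    "nat \<Rightarrow> (nat \<Rightarrow> real^'d \<Rightarrow> real^'d) \<Rightarrow> (nat \<Rightarrow> real^'d) \<Rightarrow> bool" where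
  "similarity_family N f q \<longleftrightarrow> affine_family N f q \<and> (\<forall>i\<in>{1..N}. similarity (f i))"

definition family_fun ::
    "(nat \<Rightarrow> real^'d \<Rightarrow> real^'d) \<Rightarrow> (nat \<Rightarrow> real^'d) \<Rightarrow> nat \<Rightarrow> real \<Rightarrow> real^'d \<Rightarrow> real^'d" where
  "family_fun f q i t = (\<lambda>x. t *\<^sub>R f i x + q i)"

definition family_at ::
    "nat \<Rightarrow> (nat \<Rightarrow> real^'d \<Rightarrow> real^'d) \<Rightarrow> (nat \<Rightarrow> real^'d) \<Rightarrow> real \<Rightarrow> (real^'d \<Rightarrow> real^'d) set" where
  "family_at N f q t = (\<lambda>i. family_fun f q i t) ` {1..N}"

definition hutchinson :: "('a \<Rightarrow> 'a) set \<Rightarrow> 'a set \<Rightarrow> 'a set" where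
  "hutchinson \<F> K = (\<Union>g\<in>\<F>. g ` K)"

(* Only used for non-empty compact sets, where both suprema are finite. *)
definition hausdorff_dist :: "'a::metric_space set \<Rightarrow> 'a set \<Rightarrow> real" where
  "hausdorff_dist A B = max (SUP a\<in>A. infdist a B) (SUP b\<in>B. infdist b A)"

definition is_attractor :: "('a::metric_space \<Rightarrow> 'a) set \<Rightarrow> 'a set \<Rightarrow> bool" where
  "is_attractor \<F> A \<longleftrightarrow> A \<noteq> {} \<and> compact A \<and>
     (\<forall>K. K \<noteq> {} \<longrightarrow> compact K \<longrightarrow>
        (\<lambda>k. hausdorff_dist ((hutchinson \<F> ^^ k) K) A) \<longlonglongrightarrow> 0)"

(* Limits in the Hausdorff metric are unique, so there is at most one attractor. *)
definition attractor :: "('a::metric_space \<Rightarrow> 'a) set \<Rightarrow> 'a set" where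
  "attractor \<F> = (THE A. is_attractor \<F> A)"

definition word_product ::
    "(nat \<Rightarrow> real^'d \<Rightarrow> real^'d) \<Rightarrow> nat list \<Rightarrow> real^'d^'d" where
  "word_product f w = foldr (\<lambda>i M. linear_part (f i) ** M) w (mat 1)"

(* The matrix norm is the Euclidean operator norm; the limit superior does not depend on
   the choice of norm. *)
definition joint_spectral_radius ::
    "nat \<Rightarrow> (nat \<Rightarrow> real^'d \<Rightarrow> real^'d) \<Rightarrow> ereal" where
  "joint_spectral_radius N f =
     limsup (\<lambda>k. ereal (root k
       (Max ((\<lambda>w. onorm ((*v) (word_product f w))) ` {w. length w = k \<and> set w \<subseteq> {1..N}}))))"

definition parameter_bound :: "nat \<Rightarrow> (nat \<Rightarrow> real^'d \<Rightarrow> real^'d) \<Rightarrow> ereal" where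
  "parameter_bound N f = 1 / joint_spectral_radius N f"

definition parameters :: "nat \<Rightarrow> (nat \<Rightarrow> real^'d \<Rightarrow> real^'d) \<Rightarrow> real set" where
  "parameters N f = {t. 0 \<le> t \<and> ereal t < parameter_bound N f}"

definition conjugate_by :: "('a \<Rightarrow> 'a) \<Rightarrow> ('a \<Rightarrow> 'a) \<Rightarrow> ('a \<Rightarrow> 'a) \<Rightarrow> bool" where
  "conjugate_by h f g \<longleftrightarrow> bij h \<and> g = inv h \<circ> f \<circ> h"

(* The linear function g may depend on t and may be singular: at t = 0 every member of the
   family is constant, hence conjugate to the zero map. *)
definition semi_linear ::
    "nat \<Rightarrow> (nat \<Rightarrow> real^'d \<Rightarrow> real^'d) \<Rightarrow> (nat \<Rightarrow> real^'d) \<Rightarrow> bool" where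
  "semi_linear N f q \<longleftrightarrow>
     (\<forall>i\<in>{1..N}. \<exists>h. \<forall>t\<in>parameters N f.
        \<exists>g. linear g \<and> conjugate_by h (family_fun f q i t) g)"

(* Uniqueness is that of a member of F_t as a function of both t and x (equivalently, of the
   pair (f i, q i)), so an index repeating the same pair does not count as a second member. *)
definition bounded_family ::
    "nat \<Rightarrow> (nat \<Rightarrow> real^'d \<Rightarrow> real^'d) \<Rightarrow> (nat \<Rightarrow> real^'d) \<Rightarrow> bool" where
  "bounded_family N f q \<longleftrightarrow> similarity_family N f q \<and> semi_linear N f q \<and>
     (\<exists>!\<phi>. \<exists>i\<in>{1..N}. \<phi> = family_fun f q i \<and>
        (\<forall>j\<in>{1..N}. scaling_ratio (f j) \<le> scaling_ratio (f i)))"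

end

theory Submission
  imports Defs
begin

text \<open>
  Semi-linearity makes the fixed points of the family independent of the parameter. Since
  \<open>t = 0\<close> is a parameter and \<open>f\<^sub>(\<^sub>i\<^sub>,\<^sub>0\<^sub>)\<close> is the constant \<open>q\<^sub>i\<close>, the conjugating map \<open>h\<^sub>i\<close> sends
  \<open>0\<close> to \<open>q\<^sub>i\<close>, so that \<open>f\<^sub>(\<^sub>i\<^sub>,\<^sub>t\<^sub>)\<close> multiplies distances by \<open>t r\<^sub>i\<close> and fixes \<open>q\<^sub>i\<close> for every
  parameter \<open>t\<close>. The words that repeat a single letter show that the joint spectral radius is at
  least the maximal ratio \<open>r\<^sub>*\<close>, whence \<open>t r\<^sub>* < 1\<close>.

  Take a closed ball of radius \<open>R\<close> about the fixed point \<open>q\<^sub>*\<close> of the member of maximal ratio.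
  That member maps the ball into itself. Every other member has \<open>r\<^sub>i < r\<^sub>*\<close>, so its ratio
  \<open>t r\<^sub>i\<close> stays below \<open>r\<^sub>i / r\<^sub>* < 1\<close> uniformly in \<open>t\<close>, and it maps the ball into itself as
  soon as \<open>R\<close> is large compared with the distance from \<open>q\<^sub>i\<close> to \<open>q\<^sub>*\<close>; how large does not
  depend on \<open>t\<close>. This is where uniqueness of the maximal member enters: for a second member of
  ratio \<open>r\<^sub>*\<close> with another fixed point, the radius that this estimate demands tends to infinity
  as \<open>t\<close> approaches \<open>1 / r\<^sub>*\<close>.

  Hutchinson's theorem then locates the attractor. For a finite set of contractions that maps a
  non-empty compact set \<open>B\<close> into itself, the attractor is the intersection of the iterates of \<open>B\<close> under
  the Hutchinson operator, and so lies in \<open>B\<close>. Existence and uniqueness are proved here as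
  well, because the attractor is defined by a definite description.
\<close>

section \<open>The Hausdorff distance\<close>

lemma bdd_above_infdist_compact:
  assumes "compact K"
  shows "bdd_above ((\<lambda>x. infdist x L) ` K)"
proof (intro bounded_imp_bdd_above compact_imp_bounded compact_continuous_image assms)
  show "continuous_on K (\<lambda>x. infdist x L)" by (intro continuous_intros)
qed

lemma hausdorff_dist_commute: "hausdorff_dist K L = hausdorff_dist L K"
  by (simp add: hausdorff_dist_def max.commute)

lemma infdist_le_hausdorff_dist:
  assumes "compact K" "x \<in> K"
  shows "infdist x L \<le> hausdorff_dist K L"
proof -
  have "infdist x L \<le> (SUP a\<in>K. infdist a L)"
    using assms by (intro cSUP_upper bdd_above_infdist_compact)
  then show ?thesis by (simp add: hausdorff_dist_def)
qed

lemma hausdorff_dist_nonneg: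
  assumes "compact K" "K \<noteq> {}"
  shows "0 \<le> hausdorff_dist K L"
proof -
  obtain x where "x \<in> K" using assms by auto
  then show ?thesis
    using infdist_le_hausdorff_dist[OF assms(1), of x L] infdist_nonneg[of x L] by linarith
qed

lemma hausdorff_dist_le:
  assumes "K \<noteq> {}" "L \<noteq> {}"
    and "\<And>x. x \<in> K \<Longrightarrow> infdist x L \<le> e" "\<And>y. y \<in> L \<Longrightarrow> infdist y K \<le> e"
  shows "hausdorff_dist K L \<le> e"
  using assms by (auto simp: hausdorff_dist_def intro!: cSUP_least)

lemma hausdorff_dist_zero_imp_eq:
  assumes "compact K" "K \<noteq> {}" "compact L" "L \<noteq> {}" "hausdorff_dist K L = 0"
  shows "K = L"
proof -
  have *: "X \<subseteq> Y"
    if "compact X" "compact Y" "Y \<noteq> {}" "hausdorff_dist X Y = 0" for X Y :: "'a set"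
  proof
    fix x assume "x \<in> X"
    then have "infdist x Y = 0"
      using infdist_le_hausdorff_dist[of X x Y] infdist_nonneg[of x Y] that by simp
    then show "x \<in> Y" using that by (simp add: in_closed_iff_infdist_zero compact_imp_closed)
  qed
  show ?thesis
    using *[of K L] *[of L K] assms by (auto simp: hausdorff_dist_commute[of L K])
qed

section \<open>Hutchinson's theorem\<close>

lemma hutchinson_mono: "K \<subseteq> L \<Longrightarrow> hutchinson \<F> K \<subseteq> hutchinson \<F> L"
  by (auto simp: hutchinson_def)

lemma continuous_on_if_lipschitz_bound:
  fixes g :: "'a::metric_space \<Rightarrow> 'b::metric_space"
  assumes "\<And>x y. dist (g x) (g y) \<le> c * dist x y" "0 \<le> c"
  shows "continuous_on S g"
  by (rule lipschitz_on_continuous_on[of c]) (use assms in \<open>auto intro: lipschitz_onI\<close>)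

lemma infdist_image_le:
  fixes g :: "'a::heine_borel \<Rightarrow> 'a"
  assumes "\<And>x y. dist (g x) (g y) \<le> c * dist x y" "closed L" "L \<noteq> {}"
  shows "infdist (g x) (g ` L) \<le> c * infdist x L"
proof -
  obtain l where "l \<in> L" "infdist x L = dist x l"
    using infdist_attains_inf[OF assms(2,3)] by blast
  then show ?thesis
    by (metis assms(1) imageI infdist_le2)
qed

locale contraction_family =
  fixes \<F> :: "('a::heine_borel \<Rightarrow> 'a) set" and c :: real
  assumes finite: "finite \<F>" and nonempty: "\<F> \<noteq> {}"
    and c_nonneg: "0 \<le> c" and c_less_1: "c < 1"
    and contraction: "\<And>g x y. g \<in> \<F> \<Longrightarrow> dist (g x) (g y) \<le> c * dist x y"
begin

lemma continuous: "g \<in> \<F> \<Longrightarrow> continuous_on S g"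
  using continuous_on_if_lipschitz_bound contraction c_nonneg by blast

lemma compact_hutchinson: "compact K \<Longrightarrow> compact (hutchinson \<F> K)"
  unfolding hutchinson_def using finite continuous
  by (intro compact_UN compact_continuous_image) auto

lemma hutchinson_nonempty: "K \<noteq> {} \<Longrightarrow> hutchinson \<F> K \<noteq> {}"
  using nonempty by (auto simp: hutchinson_def)

lemma compact_iterate: "compact K \<Longrightarrow> compact ((hutchinson \<F> ^^ k) K)"
  by (induction k) (auto intro: compact_hutchinson)

lemma iterate_nonempty: "K \<noteq> {} \<Longrightarrow> (hutchinson \<F> ^^ k) K \<noteq> {}"
  by (induction k) (simp_all add: hutchinson_nonempty)

lemma hausdorff_dist_hutchinson:
  assumes "compact K" "K \<noteq> {}" "compact L" "L \<noteq> {}"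
  shows "hausdorff_dist (hutchinson \<F> K) (hutchinson \<F> L) \<le> c * hausdorff_dist K L"
proof -
  have *: "infdist y (hutchinson \<F> Y) \<le> c * hausdorff_dist X Y"
    if y: "y \<in> hutchinson \<F> X" and XY: "compact X" "compact Y" "Y \<noteq> {}" for X Y y
  proof -
    obtain g x where g: "g \<in> \<F>" "x \<in> X" "y = g x"
      using y by (auto simp: hutchinson_def)
    have "infdist (g x) (hutchinson \<F> Y) \<le> infdist (g x) (g ` Y)"
      using g XY by (intro infdist_mono) (auto simp: hutchinson_def)
    also have "\<dots> \<le> c * infdist x Y"
      using contraction[OF g(1)] XY by (intro infdist_image_le) (auto intro: compact_imp_closed)
    also have "\<dots> \<le> c * hausdorff_dist X Y"
      using g XY c_nonneg by (intro mult_left_mono infdist_le_hausdorff_dist)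
    finally show ?thesis using g by simp
  qed
  show ?thesis
    using *[of _ K L] *[of _ L K] assms
    by (intro hausdorff_dist_le hutchinson_nonempty) (auto simp: hausdorff_dist_commute[of L K])
qed

lemma hausdorff_dist_iterate:
  assumes "compact K" "K \<noteq> {}" "compact L" "L \<noteq> {}"
  shows "hausdorff_dist ((hutchinson \<F> ^^ k) K) ((hutchinson \<F> ^^ k) L)
    \<le> c ^ k * hausdorff_dist K L"
proof (induction k)
  case (Suc k)
  have "hausdorff_dist ((hutchinson \<F> ^^ Suc k) K) ((hutchinson \<F> ^^ Suc k) L)
      \<le> c * hausdorff_dist ((hutchinson \<F> ^^ k) K) ((hutchinson \<F> ^^ k) L)"
    using assms by (simp add: hausdorff_dist_hutchinson compact_iterate iterate_nonempty)
  also have "\<dots> \<le> c * (c ^ k * hausdorff_dist K L)"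
    using Suc c_nonneg by (rule mult_left_mono)
  finally show ?case by (simp add: mult.assoc)
qed simp

text \<open>An invariant compact set attracts every compact set, since the iterates of both sets
  approach each other geometrically and the invariant set does not move.\<close>

lemma is_attractor_if_invariant:
  assumes A: "compact A" "A \<noteq> {}" "hutchinson \<F> A = A"
  shows "is_attractor \<F> A"
  unfolding is_attractor_def
proof (intro conjI allI impI)
  fix K :: "'a set" assume K: "K \<noteq> {}" "compact K"
  have fixed: "(hutchinson \<F> ^^ k) A = A" for k
    by (induction k) (auto simp: A)
  have "(\<lambda>k. c ^ k * hausdorff_dist K A) \<longlonglongrightarrow> 0"
    using c_nonneg c_less_1 by (intro tendsto_mult_left_zero LIMSEQ_power_zero) auto
  then show "(\<lambda>k. hausdorff_dist ((hutchinson \<F> ^^ k) K) A) \<longlonglongrightarrow> 0"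
  proof (rule tendsto_sandwich[OF always_eventually always_eventually tendsto_const, rotated 2]; intro allI)
    fix k
    show "0 \<le> hausdorff_dist ((hutchinson \<F> ^^ k) K) A"
      using K by (intro hausdorff_dist_nonneg compact_iterate iterate_nonempty)
    show "hausdorff_dist ((hutchinson \<F> ^^ k) K) A \<le> c ^ k * hausdorff_dist K A"
      using hausdorff_dist_iterate[of K A k] K A by (simp add: fixed)
  qed
qed (use A in auto)

text \<open>The iterates of an invariant set are constant, so convergence to an attractor puts the
  two sets at Hausdorff distance zero.\<close>

lemma attractor_eq_invariant:
  assumes A: "compact A" "A \<noteq> {}" "hutchinson \<F> A = A"
  shows "attractor \<F> = A"
  unfolding attractor_def
proof (rule the_equality)
  show "is_attractor \<F> A" by (rule is_attractor_if_invariant[OF A])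
next
  fix A' assume A': "is_attractor \<F> A'"
  have fixed: "(hutchinson \<F> ^^ k) A = A" for k
    by (induction k) (auto simp: A)
  have "(\<lambda>k. hausdorff_dist ((hutchinson \<F> ^^ k) A) A') \<longlonglongrightarrow> 0"
    using A A' by (auto simp: is_attractor_def)
  then have "hausdorff_dist A A' = 0"
    by (simp add: fixed LIMSEQ_const_iff)
  then show "A' = A"
    using hausdorff_dist_zero_imp_eq[of A A'] A A' by (auto simp: is_attractor_def)
qed

text \<open>The Hutchinson operator commutes with the intersection of a decreasing sequence of compact
  sets: by the pigeonhole principle, a point in every image \<open>\<F>(S\<^sub>k)\<close> lies in \<open>g(S\<^sub>k)\<close> for
  infinitely many \<open>k\<close> with one and the same \<open>g\<close>, hence for all \<open>k\<close>, and then compactness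
  yields a common preimage.\<close>

lemma hutchinson_Inter_decreasing:
  fixes S :: "nat \<Rightarrow> 'a set"
  assumes comp: "\<And>k. compact (S k)" and dec: "\<And>m n. m \<le> n \<Longrightarrow> S n \<subseteq> S m"
  shows "hutchinson \<F> (\<Inter>k. S k) = (\<Inter>k. hutchinson \<F> (S k))"
proof (intro equalityI subsetI)
  fix x assume x: "x \<in> (\<Inter>k. hutchinson \<F> (S k))"
  have "\<exists>g\<in>\<F>. \<forall>k. x \<in> g ` S k"
  proof (rule ccontr)
    assume "\<not> ?thesis"
    then obtain n where n: "\<And>g. g \<in> \<F> \<Longrightarrow> x \<notin> g ` S (n g)" by metis
    define m where "m = Max (n ` \<F>)"
    obtain g where g: "g \<in> \<F>" "x \<in> g ` S m"
      using x unfolding hutchinson_def by blast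
    have "n g \<le> m" using finite g by (simp add: m_def)
    then show False using n[OF g(1)] g(2) dec by blast
  qed
  then obtain g where g: "g \<in> \<F>" "\<And>k. x \<in> g ` S k" by blast
  have "(\<Inter>k. S k \<inter> g -` {x}) \<noteq> {}"
  proof (rule compact_nest)
    show "compact (S k \<inter> g -` {x})" for k
      using continuous[OF g(1)] comp by (intro compact_Int_closed closed_vimage) auto
    show "S k \<inter> g -` {x} \<noteq> {}" for k using g(2)[of k] by auto
    show "S n \<inter> g -` {x} \<subseteq> S m \<inter> g -` {x}" if "m \<le> n" for m n using dec[OF that] by auto
  qed
  then show "x \<in> hutchinson \<F> (\<Inter>k. S k)"
    using g(1) by (auto simp: hutchinson_def)
qed (auto simp: hutchinson_def)

theorem attractor_subset_invariant_compact:
  assumes B: "compact B" "B \<noteq> {}" and inv: "hutchinson \<F> B \<subseteq> B"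
  shows "attractor \<F> \<subseteq> B"
proof -
  define S where "S k = (hutchinson \<F> ^^ k) B" for k
  have "S (Suc k) \<subseteq> S k" for k
    by (induction k) (simp_all add: S_def inv hutchinson_mono)
  then have dec: "S n \<subseteq> S m" if "m \<le> n" for m n
    using that by (rule lift_Suc_antimono_le)
  have comp: "compact (S k)" and ne: "S k \<noteq> {}" for k
    using B by (simp_all add: S_def compact_iterate iterate_nonempty)
  have "hutchinson \<F> (\<Inter>k. S k) = (\<Inter>k. S (Suc k))"
    using hutchinson_Inter_decreasing[OF comp dec] by (simp add: S_def)
  also have "\<dots> = (\<Inter>k. S k)"
    using dec[OF le_SucI[OF order_refl]] by blast
  finally have "attractor \<F> = (\<Inter>k. S k)"
    using comp ne dec
    by (intro attractor_eq_invariant compact_nest compact_Inter) auto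
  also have "\<dots> \<subseteq> S 0" by blast
  finally show ?thesis by (simp add: S_def)
qed

end

section \<open>Ratios and the joint spectral radius\<close>

lemma linear_part_affine:
  fixes L :: "real^'d^'d"
  assumes f: "f = (\<lambda>x. L *v x + a)"
  shows "linear_part f = L"
  unfolding linear_part_def
proof (rule the_equality)
  fix M assume "\<exists>b. f = (\<lambda>x. M *v x + b)"
  then obtain b where b: "\<And>x. L *v x + a = M *v x + b" using f by metis
  have "a = b" using b[of 0] by simp
  then have "L *v x = M *v x" for x using b[of x] by simp
  then show "M = L" by (simp add: matrix_eq)
qed (use f in blast)

lemma scaling_ratio_eqI:
  fixes f :: "real^'d \<Rightarrow> real^'d"
  assumes "\<And>x y. dist (f x) (f y) = r * dist x y"
  shows "scaling_ratio f = r"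
  unfolding scaling_ratio_def
proof (rule the_equality)
  fix s assume s: "\<forall>x y. dist (f x) (f y) = s * dist x y"
  obtain v :: "real^'d" where "v \<noteq> 0" using vector_choose_size[of 1] by force
  then show "s = r" using assms[of v 0] s[rule_format, of v 0] by simp
qed (use assms in blast)

lemma similarity_scaling_ratio:
  fixes f :: "real^'d \<Rightarrow> real^'d"
  assumes "similarity f"
  shows "0 < scaling_ratio f" "dist (f x) (f y) = scaling_ratio f * dist x y"
  using assms scaling_ratio_eqI[of f] by (auto simp: similarity_def)

lemma norm_linear_part_similarity:
  fixes f :: "real^'d \<Rightarrow> real^'d"
  assumes "nonsingular_affine f" "similarity f"
  shows "norm (linear_part f *v v) = scaling_ratio f * norm v"
proof -
  obtain L a where f: "f = (\<lambda>x. L *v x + a)"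
    using assms(1) by (auto simp: nonsingular_affine_def)
  show ?thesis
    using similarity_scaling_ratio(2)[OF assms(2), of v 0]
    unfolding linear_part_affine[OF f] by (simp add: f dist_norm)
qed

lemma norm_word_product_replicate:
  assumes "\<And>v. norm (linear_part (f i) *v v) = r * norm v"
  shows "norm (word_product f (replicate k i) *v v) = r ^ k * norm v"
proof (induction k)
  case (Suc k)
  have "word_product f (replicate (Suc k) i) *v v
      = linear_part (f i) *v (word_product f (replicate k i) *v v)"
    by (simp add: word_product_def matrix_vector_mul_assoc)
  then show ?case using assms Suc by simp
qed (simp add: word_product_def)

text \<open>The word that repeats the letter \<open>i\<close> bounds the maximum over words of length \<open>k\<close>
  from below by \<open>r ^ k\<close>.\<close>

lemma joint_spectral_radius_ge:
  fixes f :: "nat \<Rightarrow> real^'d \<Rightarrow> real^'d"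
  assumes i: "i \<in> {1..N}" and r: "0 \<le> r"
    and norm_L: "\<And>v. norm (linear_part (f i) *v v) = r * norm v"
  shows "ereal r \<le> joint_spectral_radius N f"
  unfolding joint_spectral_radius_def
proof (intro le_Limsup)
  have "r \<le> root k (Max ((\<lambda>w. onorm ((*v) (word_product f w))) `
      {w. length w = k \<and> set w \<subseteq> {1..N}}))" (is "r \<le> root k (Max ?S)") if k: "k > 0" for k
  proof -
    have "finite {w. length w = k \<and> set w \<subseteq> {1..N}}"
      using finite_lists_length_eq[of "{1..N}" k] by (simp add: conj_commute)
    then have fin: "finite ?S" by simp
    define v :: "real^'d" where "v = axis undefined 1"
    have v: "norm v = 1" by (simp add: v_def norm_axis_1)
    have "r ^ k \<le> onorm ((*v) (word_product f (replicate k i)))"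
      using onorm[OF matrix_vector_mul_bounded_linear, of "word_product f (replicate k i)" v]
        norm_word_product_replicate[of f i r k v] norm_L v by simp
    also have "\<dots> \<le> Max ?S"
      using fin i k by (intro Max_ge imageI) auto
    finally have "root k (r ^ k) \<le> root k (Max ?S)" using k by simp
    then show ?thesis using k r by (simp add: real_root_power_cancel)
  qed
  then show "\<forall>\<^sub>F k in sequentially. ereal r \<le> ereal (root k (Max ((\<lambda>w. onorm ((*v) (word_product f w))) `
      {w. length w = k \<and> set w \<subseteq> {1..N}})))"
    by (intro eventually_sequentiallyI[of 1]) simp
qed simp

lemma parameter_times_ratio_less_1:
  fixes f :: "nat \<Rightarrow> real^'d \<Rightarrow> real^'d"
  assumes "similarity_family N f q" "i \<in> {1..N}" "t \<in> parameters N f"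
  shows "t * scaling_ratio (f i) < 1"
proof -
  have i: "nonsingular_affine (f i)" "similarity (f i)"
    using assms by (auto simp: similarity_family_def affine_family_def)
  define r where "r = scaling_ratio (f i)"
  have r: "0 < r" using similarity_scaling_ratio(1)[OF i(2)] by (simp add: r_def)
  have le: "ereal r \<le> joint_spectral_radius N f"
    using assms(2) r norm_linear_part_similarity[OF i]
    by (intro joint_spectral_radius_ge[of i]) (auto simp: r_def)
  have t: "0 \<le> t" "ereal t < 1 / joint_spectral_radius N f"
    using assms(3) by (auto simp: parameters_def parameter_bound_def)
  have "t * r < 1"
  proof (cases "joint_spectral_radius N f")
    case (real \<rho>)
    then have \<rho>: "r \<le> \<rho>" "0 < \<rho>" using le r by auto
    then have "t < 1 / \<rho>" using t real by (simp add: one_ereal_def)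
    then have "t * \<rho> < 1" using \<rho> by (simp add: field_simps)
    moreover have "t * r \<le> t * \<rho>" using \<rho> t by (intro mult_left_mono) auto
    ultimately show ?thesis by simp
  qed (use le t in \<open>auto simp: zero_ereal_def\<close>)
  then show ?thesis by (simp add: r_def)
qed

section \<open>Semi-linear families\<close>

text \<open>A map conjugate to a linear one by \<open>h\<close> fixes \<open>h 0\<close>. At the parameter \<open>0\<close> the
  only fixed point is \<open>q i\<close>, and \<open>h\<close> is the same for all parameters.\<close>

lemma semi_linear_fixed_point:
  assumes "semi_linear N f q" "i \<in> {1..N}" "t \<in> parameters N f"
  shows "family_fun f q i t (q i) = q i"
proof -
  obtain h where h: "\<And>s. s \<in> parameters N f \<Longrightarrow>
      \<exists>g. linear g \<and> conjugate_by h (family_fun f q i s) g"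
    using assms(1,2) unfolding semi_linear_def by blast
  have fixed: "family_fun f q i s (h 0) = h 0" if s: "s \<in> parameters N f" for s
  proof -
    obtain g where g: "linear g" "bij h" "g = inv h \<circ> family_fun f q i s \<circ> h"
      using h[OF s] by (auto simp: conjugate_by_def)
    have "inv h (family_fun f q i s (h 0)) = 0"
      using linear_0[OF g(1)] g(3) by simp
    then show ?thesis
      using g(2) by (metis bij_inv_eq_iff)
  qed
  have "ereal 0 \<le> ereal t" "ereal t < parameter_bound N f"
    using assms(3) by (auto simp: parameters_def)
  then have "ereal 0 < parameter_bound N f" by (rule le_less_trans)
  then have "0 \<in> parameters N f" by (simp add: parameters_def)
  then have "h 0 = q i" using fixed[of 0] by (simp add: family_fun_def)
  then show ?thesis using fixed[OF assms(3)] by simp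
qed

lemma dist_family_fun:
  assumes "similarity (f i)" "0 \<le> t"
  shows "dist (family_fun f q i t x) (family_fun f q i t y) = t * scaling_ratio (f i) * dist x y"
  using similarity_scaling_ratio(2)[OF assms(1), of x y] assms(2)
  by (simp add: family_fun_def dist_norm flip: scaleR_right_diff_distrib)

text \<open>With \<open>D = dist p q\<close> and \<open>\<lambda> = r / s\<close>, a map of ratio at most \<open>\<lambda>\<close> fixing \<open>p\<close>
  sends the ball of radius \<open>R\<close> about \<open>q\<close> into the ball of radius
  \<open>\<lambda> (R + D) + D\<close>. This is at most \<open>R\<close> once \<open>R \<ge> D (1 + \<lambda>) / (1 - \<lambda>)\<close>.\<close>

lemma fixed_point_contraction_maps_cball:
  fixes g :: "'a::metric_space \<Rightarrow> 'a"
  assumes lip: "\<And>x y. dist (g x) (g y) \<le> t * r * dist x y" and fixed: "g p = p"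
    and r: "0 < r" "r < s" and t: "t * s < 1"
    and R: "dist p q * (s + r) / (s - r) \<le> R" and x: "x \<in> cball q R"
  shows "g x \<in> cball q R"
proof -
  have xR: "dist x q \<le> R" using x by (simp add: dist_commute)
  have "t \<le> 1 / s" using t r by (simp add: field_simps)
  then have "t * r \<le> 1 / s * r" using r by (intro mult_right_mono) auto
  then have tr: "t * r \<le> r / s" by simp
  have "dist (g x) q \<le> dist (g x) (g p) + dist p q"
    using dist_triangle[of "g x" q p] fixed by simp
  also have "dist (g x) (g p) \<le> r / s * dist x p"
    using lip[of x p] tr by (meson mult_right_mono order_trans zero_le_dist)
  also have "r / s * dist x p \<le> r / s * (R + dist p q)"
    using r xR dist_triangle[of x p q] by (intro mult_left_mono) (auto simp: dist_commute)
  also have "r / s * (R + dist p q) + dist p q \<le> R"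
    using R r by (simp add: field_simps)
  finally show ?thesis by (simp add: dist_commute)
qed

text \<open>Members of maximal ratio share their fixed point by uniqueness, and contract every ball
  about it; the remaining ones determine how large the radius has to be.\<close>

lemma bounded_family_common_ball:
  fixes f :: "nat \<Rightarrow> real^'d \<Rightarrow> real^'d"
  assumes "bounded_family N f q"
  shows "\<exists>p R. 0 \<le> R \<and>
    (\<forall>t\<in>parameters N f. hutchinson (family_at N f q t) (cball p R) \<subseteq> cball p R)"
proof -
  define r where "r i = scaling_ratio (f i)" for i
  have fam: "similarity_family N f q" and semi: "semi_linear N f q"
    and uniq: "\<exists>!\<phi>. \<exists>i\<in>{1..N}. \<phi> = family_fun f q i \<and> (\<forall>j\<in>{1..N}. r j \<le> r i)"
    using assms by (auto simp: bounded_family_def r_def)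
  obtain m where m: "m \<in> {1..N}" "\<And>j. j \<in> {1..N} \<Longrightarrow> r j \<le> r m"
    using uniq by blast
  have same_q: "q j = q m" if j: "j \<in> {1..N}" "r j = r m" for j
  proof -
    have "\<forall>k\<in>{1..N}. r k \<le> r j" using j m by simp
    then have "family_fun f q j = family_fun f q m"
      using uniq j(1) m by metis
    then have "family_fun f q j 0 0 = family_fun f q m 0 0" by simp
    then show ?thesis by (simp add: family_fun_def)
  qed
  have sim: "similarity (f i)" if "i \<in> {1..N}" for i
    using fam that by (auto simp: similarity_family_def)
  have r_pos: "0 < r i" if "i \<in> {1..N}" for i
    using similarity_scaling_ratio(1)[OF sim[OF that]] by (simp add: r_def)
  define R where "R = Max (insert 0 ((\<lambda>j. dist (q j) (q m) * (r m + r j) / (r m - r j)) ` {1..N}))"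
  have R_nonneg: "0 \<le> R" unfolding R_def by (rule Max_ge) auto
  have R_ge: "dist (q j) (q m) * (r m + r j) / (r m - r j) \<le> R" if "j \<in> {1..N}" for j
    unfolding R_def using that by (intro Max_ge) auto
  have "family_fun f q i t x \<in> cball (q m) R"
    if i: "i \<in> {1..N}" and t: "t \<in> parameters N f" and x: "x \<in> cball (q m) R" for i t x
  proof -
    have t0: "0 \<le> t" using t by (simp add: parameters_def)
    have tm: "t * r m < 1"
      using parameter_times_ratio_less_1[OF fam m(1) t] by (simp add: r_def)
    have fixed: "family_fun f q i t (q i) = q i"
      by (rule semi_linear_fixed_point[OF semi i t])
    have lip: "dist (family_fun f q i t y) (family_fun f q i t z) = t * r i * dist y z" for y z
      using dist_family_fun[of f i t q y z] sim[OF i] t0 by (simp add: r_def)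
    show ?thesis
    proof (cases "r i = r m")
      case True
      then have "dist (q m) (family_fun f q i t x) = t * r m * dist (q m) x"
        using lip[of "q i" x] fixed same_q[OF i] by simp
      also have "\<dots> \<le> 1 * dist (q m) x"
        using tm by (intro mult_right_mono) auto
      finally show ?thesis using x by simp
    next
      case False
      then have "r i < r m" using m(2)[OF i] by simp
      then show ?thesis
        using lip tm R_ge[OF i] x
        by (intro fixed_point_contraction_maps_cball[where g = "family_fun f q i t" and t = t
              and r = "r i" and s = "r m" and p = "q i", OF _ fixed r_pos[OF i]]) auto
    qed
  qed
  then have "hutchinson (family_at N f q t) (cball (q m) R) \<subseteq> cball (q m) R"
    if "t \<in> parameters N f" for t
    using that unfolding hutchinson_def family_at_def by blast
  then show ?thesis using R_nonneg by blast
qed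

lemma contraction_family_family_at:
  fixes f :: "nat \<Rightarrow> real^'d \<Rightarrow> real^'d"
  assumes fam: "similarity_family N f q" and t: "t \<in> parameters N f"
  shows "\<exists>c. contraction_family (family_at N f q t) c"
proof -
  define c where "c = Max ((\<lambda>i. t * scaling_ratio (f i)) ` {1..N})"
  have N: "{1..N} \<noteq> {}" and sim: "\<And>i. i \<in> {1..N} \<Longrightarrow> similarity (f i)"
    using fam by (auto simp: similarity_family_def affine_family_def)
  have t0: "0 \<le> t" using t by (simp add: parameters_def)
  have le_c: "t * scaling_ratio (f i) \<le> c" if "i \<in> {1..N}" for i
    unfolding c_def using that by (intro Max_ge) auto
  obtain i where i: "i \<in> {1..N}" using N by blast
  have "0 \<le> t * scaling_ratio (f i)"
    using t0 similarity_scaling_ratio(1)[OF sim[OF i]] by simp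
  then have "0 \<le> c" using le_c[OF i] by simp
  moreover have "c < 1"
    unfolding c_def using N parameter_times_ratio_less_1[OF fam _ t] by (subst Max_less_iff) auto
  moreover have "dist (g x) (g y) \<le> c * dist x y" if "g \<in> family_at N f q t" for g x y
  proof -
    obtain j where j: "j \<in> {1..N}" "g = family_fun f q j t"
      using \<open>g \<in> family_at N f q t\<close> by (auto simp: family_at_def)
    show ?thesis
      using dist_family_fun[of f j t q x y] sim[OF j(1)] t0 j(2) mult_right_mono[OF le_c[OF j(1)]]
      by simp
  qed
  ultimately show ?thesis
    using N by (intro exI[of _ c]) (unfold_locales; auto simp: family_at_def)
qed

section \<open>Attractors of a bounded family\<close>

theorem corollary8p1:
  fixes N :: nat
    and f :: "nat \<Rightarrow> real^'d \<Rightarrow> real^'d"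
    and q :: "nat \<Rightarrow> real^'d"
  assumes "bounded_family N f q"
  shows "\<exists>c r. 0 < r \<and> (\<forall>t\<in>parameters N f. attractor (family_at N f q t) \<subseteq> ball c r)"
proof -
  obtain p R where R: "0 \<le> R"
    and inv: "\<And>t. t \<in> parameters N f \<Longrightarrow>
      hutchinson (family_at N f q t) (cball p R) \<subseteq> cball p R"
    using bounded_family_common_ball[OF assms] by blast
  have "attractor (family_at N f q t) \<subseteq> ball p (R + 1)" if t: "t \<in> parameters N f" for t
  proof -
    obtain c where "contraction_family (family_at N f q t) c"
      using contraction_family_family_at[OF _ t] assms unfolding bounded_family_def by blast
    then have "attractor (family_at N f q t) \<subseteq> cball p R"
      using R inv[OF t] by (intro contraction_family.attractor_subset_invariant_compact) auto
    then show ?thesis by auto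
  qed
  then show ?thesis using R by (intro exI[of _ p] exI[of _ "R + 1"]) auto
qed

end
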